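(* Let $d\ge 1$ be an integer and let $\mathcal{F}^*$ be the interval subdivision of $(d-1)$-dimensional simplicial complexes. Then its transformation matrix $H_{\mathcal{F}^*}$ (a $(d+1)\times(d+1)$ real matrix) is totally positive, i.e. all minors of all orders of $H_{\mathcal{F}^*}$ are non-negative.
   Context: Rows and columns of matrices are indexed starting from $0$. All simplicial complexes are finite. For a $(d-1)$-dimensional simplicial complex $\Delta$ with $f_{i-1}$ faces of dimension $i-1$ ($f_{-1}=1$), the $h$-vector $h^\Delta=(h_0,\dots,h_d)$ is defined by $\sum_{i=0}^d h_i x^i=\sum_{i=0}^d f_{i-1}x^i(1-x)^{d-i}$. The interval subdivision of $\Delta$ is the simplicial complex of all chains in the poset of closed intervals $[A,B]=\{C: A\subseteq C\subseteq B\}$, where $A\subseteq B$ are nonempty faces of $\Delta$, ordered by inclusion of intervals. Its transformation matrix $H_{\mathcal{F}^*}=[q_d(i,j)]_{0\le i,j\le d}$ is the matrix, depending only on $d$, such that $h^{\Delta'}=H_{\mathcal{F}^*}\,h^{\Delta}$ (column vectors) for every $(d-1)$-dimensional simplicial complex $\Delta$ with interval subdivision $\Delta'$. The following explicit description of $H_{\mathcal{F}^*}$ is known (Anwar and Nazir). Let $$p_d(i,j)=\sum_{r=0}^{i} r^j (r+1)^{d-j}(-1)^{i-r}\binom{d+1}{i-r}\quad(0\le i,j\le d,\ 0^0=1),$$ which are the entries of the transformation matrix of the barycentric subdivision, and let $P_{d,j}(x)=\sum_{i=0}^d p_d(i,j)x^i$ and $Q_{d,j}(x)=\sum_{i=0}^d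 q_d(i,j)x^i$. Then $Q_{d,j}(x)=E_2\big[(1+x)^dP_{d,j}(x)\big]$ for $0\le j\le d$, where $E_2\big[\sum_{k\ge0}c_kx^k\big]=\sum_{k\ge 0}c_{2k}x^k$. *)

theory Defs
  imports
    "HOL-Computational_Algebra.Polynomial"
    "Jordan_Normal_Form.Matrix"
    "Jordan_Normal_Form.Determinant"
    "Jordan_Normal_Form.DL_Submatrix"
begin

section \<open>Simplicial complexes and their h-vectors\<close>

text \<open>A simplicial complex is identified with the set of its faces. The empty face always
  belongs to it, so that there is exactly one face of dimension \<open>-1\<close>.\<close>

definition simplicial_complex :: "'a set set \<Rightarrow> bool" where
  "simplicial_complex K \<longleftrightarrow>
     finite K \<and> (\<forall>F\<in>K. finite F) \<and> {} \<in> K \<and> (\<forall>F\<in>K. \<forall>G. G \<subseteq> F \<longrightarrow> G \<in> K)"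

definition face_dim :: "'a set \<Rightarrow> int" where
  "face_dim F = int (card F) - 1"

definition complex_dim :: "'a set set \<Rightarrow> int" where
  "complex_dim K = Max (face_dim ` K)"

definition face_count :: "'a set set \<Rightarrow> int \<Rightarrow> nat" where
  "face_count K k = card {F \<in> K. face_dim F = k}"

text \<open>For a complex of dimension \<open>d - 1\<close>, the polynomial
  \<open>\<Sum>i\<le>d. f\<^bsub>i-1\<^esub> x^i (1 - x)^(d - i)\<close>, whose coefficients are the entries of the h-vector.\<close>

definition h_polynomial :: "'a set set \<Rightarrow> real poly" where
  "h_polynomial K =
     (let d = nat (complex_dim K + 1)
      in \<Sum>i\<le>d. smult (of_nat (face_count K (int i - 1))) ([:0, 1:] ^ i * [:1, -1:] ^ (d - i)))"

definition h_vector :: "'a set set \<Rightarrow> real vec" where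
  "h_vector K = vec (nat (complex_dim K + 1) + 1) (coeff (h_polynomial K))"

section \<open>Interval subdivision\<close>

text \<open>The set interval \<open>{A..B}\<close> consists of all \<open>C\<close> with \<open>A \<subseteq> C \<subseteq> B\<close>; all of these are
  faces when \<open>B\<close> is one.\<close>

definition face_intervals :: "'a set set \<Rightarrow> 'a set set set" where
  "face_intervals K = {{A..B} | A B. A \<in> K \<and> B \<in> K \<and> A \<noteq> {} \<and> A \<subseteq> B}"

definition interval_subdivision :: "'a set set \<Rightarrow> 'a set set set set" where
  "interval_subdivision K = {\<C>. subset.chain (face_intervals K) \<C>}"

lemma simplicial_complex_interval_subdivision:
  assumes "simplicial_complex K"
  shows "simplicial_complex (interval_subdivision K)"
proof -
  have "face_intervals K \<subseteq> (\<lambda>(A, B). {A..B}) ` (K \<times> K)"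
    by (auto simp: face_intervals_def)
  with assms have fin: "finite (face_intervals K)"
    by (meson finite_SigmaI finite_imageI finite_subset simplicial_complex_def)
  have sub: "interval_subdivision K \<subseteq> Pow (face_intervals K)"
    by (auto simp: interval_subdivision_def subset_chain_def)
  have "finite (interval_subdivision K)"
    using fin sub by (meson finite_Pow_iff finite_subset)
  moreover have "\<forall>F\<in>interval_subdivision K. finite F"
    using fin sub by (meson PowD finite_subset subsetD)
  moreover have "{} \<in> interval_subdivision K"
    by (simp add: interval_subdivision_def subset_chain_def)
  moreover have "\<forall>F\<in>interval_subdivision K. \<forall>G. G \<subseteq> F \<longrightarrow> G \<in> interval_subdivision K"
    unfolding interval_subdivision_def subset_chain_def by blast
  ultimately show ?thesis
    by (simp add: simplicial_complex_def)
qed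

text \<open>Every finite complex is isomorphic to one with vertices in \<open>nat\<close>, so quantifying over
  these covers all complexes.\<close>

definition is_interval_h_matrix :: "nat \<Rightarrow> real mat \<Rightarrow> bool" where
  "is_interval_h_matrix d H \<longleftrightarrow>
     H \<in> carrier_mat (d + 1) (d + 1) \<and>
     (\<forall>K :: nat set set. simplicial_complex K \<and> complex_dim K = int d - 1 \<longrightarrow>
        h_vector (interval_subdivision K) = H *\<^sub>v h_vector K)"

text \<open>For \<open>d \<ge> 1\<close> such a matrix exists, and it is unique because the h-vectors of the complexes
  of dimension \<open>d - 1\<close> span the whole space.\<close>

definition interval_h_matrix :: "nat \<Rightarrow> real mat" where
  "interval_h_matrix d = (THE H. is_interval_h_matrix d H)"

section \<open>Total positivity\<close>

definition totally_positive :: "real mat \<Rightarrow> bool" where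
  "totally_positive A \<longleftrightarrow>
     (\<forall>I J. I \<subseteq> {..<dim_row A} \<and> J \<subseteq> {..<dim_col A} \<and> card I = card J \<longrightarrow>
        det (submatrix A I J) \<ge> 0)"

end

theory Submission
  imports
    Defs
    "HOL-Computational_Algebra.Formal_Power_Series"
    "HOL-Computational_Algebra.Polynomial_FPS"
begin

text \<open>For a function \<open>u\<close> on the natural numbers let \<open>\<Phi> u\<close> be the power series
  \<open>(1 - x)^d (u(0) + \<Sum>r\<ge>1. (u(2r) - u(2r - 1)) x^r)\<close>.

  A multichain of \<open>r\<close> intervals is a multichain of \<open>2r\<close> nonempty faces, and \<open>(2r)^k - (2r - 1)^k\<close> of
  these have a given face of cardinality \<open>k\<close> as their top. Hence the h-polynomial of the subdivision
  is \<open>\<Phi> u\<close> with \<open>u(t) = \<Sum>k. f\<^bsub>k-1\<^esub> t^k = \<Sum>j. h\<^bsub>j\<^esub> t^j (t + 1)^(d - j)\<close>, so column \<open>j\<close> of the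
  transformation matrix consists of the coefficients of \<open>\<Phi> (t^j (t + 1)^(d - j))\<close>.

  For the functions \<open>binomial (t + d - j) d\<close> in place of \<open>t^j (t + 1)^(d - j)\<close>, the coefficients are
  the even rows of the Toeplitz matrix of \<open>(1 + x)^d\<close>, which is totally positive. Both families are
  products of \<open>d\<close> consecutive linear factors for a knot sequence of length \<open>2d\<close>: the knots
  \<open>-d, \<dots>, d - 1\<close> for the binomial coefficients, and \<open>d\<close> copies each of \<open>-1\<close> and \<open>0\<close> for the
  target. Moving one knot at a time changes each function to a nonnegative combination of itself and
  a neighbour, and such column operations preserve total positivity.\<close>

unbundle fps_syntax

section \<open>Column operations preserving nonnegative minors\<close>

text \<open>Minors are indexed by increasing maps rather than index sets, so that exchanging one
  column is a function update. Only the columns are restricted; every natural number is a row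
  index.\<close>

definition tp_on :: "nat set \<Rightarrow> (nat \<Rightarrow> nat \<Rightarrow> real) \<Rightarrow> bool" where
  "tp_on J A \<longleftrightarrow>
     (\<forall>r f g. strict_mono_on {..<r} f \<longrightarrow> strict_mono_on {..<r} g \<longrightarrow> g ` {..<r} \<subseteq> J \<longrightarrow>
        det (mat r r (\<lambda>(i, j). A (f i) (g j))) \<ge> 0)"

lemma tp_onI:
  assumes "\<And>r f g. \<lbrakk>strict_mono_on {..<r} f; strict_mono_on {..<r} g; g ` {..<r} \<subseteq> J\<rbrakk>
             \<Longrightarrow> det (mat r r (\<lambda>(i, j). A (f i) (g j))) \<ge> 0"
  shows "tp_on J A"
  using assms unfolding tp_on_def by blast

lemma tp_onD:
  assumes "tp_on J A" "strict_mono_on {..<r} f" "strict_mono_on {..<r} g" "g ` {..<r} \<subseteq> J"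
  shows "det (mat r r (\<lambda>(i, j). A (f i) (g j))) \<ge> 0"
  using assms unfolding tp_on_def by blast

lemma tp_on_cong:
  assumes "tp_on J A" "\<And>i j. j \<in> J \<Longrightarrow> A i j = B i j"
  shows "tp_on J B"
proof (rule tp_onI)
  fix r :: nat and f g :: "nat \<Rightarrow> nat"
  assume *: "strict_mono_on {..<r} f" "strict_mono_on {..<r} g" "g ` {..<r} \<subseteq> J"
  have "mat r r (\<lambda>(i, j). B (f i) (g j)) = mat r r (\<lambda>(i, j). A (f i) (g j))"
    using * assms(2) by (intro eq_matI) auto
  then show "det (mat r r (\<lambda>(i, j). B (f i) (g j))) \<ge> 0"
    using tp_onD[OF assms(1) *] by simp
qed

lemma tp_on_subset: "tp_on J A \<Longrightarrow> J' \<subseteq> J \<Longrightarrow> tp_on J' A"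
  unfolding tp_on_def by blast

lemma tp_on_rows:
  assumes "tp_on J A" "strict_mono h"
  shows "tp_on J (\<lambda>i. A (h i))"
proof (rule tp_onI)
  fix r :: nat and f g :: "nat \<Rightarrow> nat"
  assume *: "strict_mono_on {..<r} f" "strict_mono_on {..<r} g" "g ` {..<r} \<subseteq> J"
  have "strict_mono_on {..<r} (h \<circ> f)"
    using * assms(2) by (auto simp: strict_mono_on_def strict_mono_def)
  from tp_onD[OF assms(1) this *(2,3)] show "det (mat r r (\<lambda>(i, j). A (h (f i)) (g j))) \<ge> 0"
    by simp
qed

lemma tp_on_scale:
  assumes "tp_on J A" "c \<ge> 0"
  shows "tp_on J (\<lambda>i j. c * A i j)"
proof (rule tp_onI)
  fix r :: nat and f g :: "nat \<Rightarrow> nat"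
  assume *: "strict_mono_on {..<r} f" "strict_mono_on {..<r} g" "g ` {..<r} \<subseteq> J"
  have "mat r r (\<lambda>(i, j). c * A (f i) (g j)) = c \<cdot>\<^sub>m mat r r (\<lambda>(i, j). A (f i) (g j))"
    by (intro eq_matI) auto
  then show "det (mat r r (\<lambda>(i, j). c * A (f i) (g j))) \<ge> 0"
    using tp_onD[OF assms(1) *] assms(2) by simp
qed

text \<open>The three matrices agree off column \<open>p\<close>, so they share the cofactors along
  it, and Laplace expansion is linear in the remaining entries.\<close>

lemma det_column_linear:
  fixes A B C :: "'a :: comm_ring_1 mat"
  assumes A: "A \<in> carrier_mat n n" and B: "B \<in> carrier_mat n n" and C: "C \<in> carrier_mat n n"
    and p: "p < n"
    and AB: "\<And>i j. i < n \<Longrightarrow> j < n \<Longrightarrow> j \<noteq> p \<Longrightarrow> A $$ (i, j) = B $$ (i, j)"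
    and AC: "\<And>i j. i < n \<Longrightarrow> j < n \<Longrightarrow> j \<noteq> p \<Longrightarrow> A $$ (i, j) = C $$ (i, j)"
    and lin: "\<And>i. i < n \<Longrightarrow> A $$ (i, p) = a * B $$ (i, p) + b * C $$ (i, p)"
  shows "det A = a * det B + b * det C"
proof -
  have B': "cofactor B i p = cofactor A i p" if "i < n" for i
  proof -
    have "mat_delete B i p = mat_delete A i p"
      using A B that p by (intro eq_matI) (auto simp: mat_delete_def AB)
    then show ?thesis by (simp add: cofactor_def)
  qed
  have C': "cofactor C i p = cofactor A i p" if "i < n" for i
  proof -
    have "mat_delete C i p = mat_delete A i p"
      using A C that p by (intro eq_matI) (auto simp: mat_delete_def AC)
    then show ?thesis by (simp add: cofactor_def)
  qed
  show ?thesis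
    unfolding laplace_expansion_column[OF A p] laplace_expansion_column[OF B p]
      laplace_expansion_column[OF C p]
    by (simp add: lin B' C' sum_distrib_left sum.distrib algebra_simps)
qed

text \<open>By linearity, a minor using column \<open>j\<close> splits into the old minor and the
  one with \<open>j\<close> exchanged for \<open>j'\<close>. Adjacency preserves the sign: the
  exchange either keeps the columns in order or repeats a column, which gives zero.\<close>

lemma tp_on_column_op:
  assumes tp: "tp_on J A" and j': "j' \<in> J" "j' = Suc j \<or> j = Suc j'" and ab: "a \<ge> 0" "b \<ge> 0"
  shows "tp_on J (\<lambda>i k. if k = j then a * A i j + b * A i j' else A i k)" (is "tp_on J ?A")
proof (rule tp_onI)
  fix r :: nat and f g :: "nat \<Rightarrow> nat"
  assume *: "strict_mono_on {..<r} f" "strict_mono_on {..<r} g" "g ` {..<r} \<subseteq> J"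
  let ?M = "\<lambda>A g. mat r r (\<lambda>(i, j). A (f i) (g j)) :: real mat"
  note tpA = tp_onD[OF tp *(1)]
  show "det (?M ?A g) \<ge> 0"
  proof (cases "j \<in> g ` {..<r}")
    case False
    then have "?M ?A g = ?M A g" by (intro eq_matI) auto
    then show ?thesis using tpA[OF *(2,3)] by simp
  next
    case True
    then obtain p where p: "p < r" "g p = j" by auto
    have inj: "inj_on g {..<r}" using *(2) by (rule strict_mono_on_imp_inj_on)
    have np: "g q \<noteq> j" if "q < r" "q \<noteq> p" for q
      using inj that p by (metis inj_on_def lessThan_iff)
    have lin: "det (?M ?A g) = a * det (?M A g) + b * det (?M A (g(p := j')))"
      by (rule det_column_linear[where p = p]) (use p np in auto)
    have "det (?M A (g(p := j'))) \<ge> 0"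
    proof (cases "j' \<in> g ` {..<r}")
      case True
      then obtain q where q: "q < r" "g q = j'" by auto
      with p j' have "p \<noteq> q" by auto
      have "det (?M A (g(p := j'))) = 0"
        by (rule det_identical_columns[of _ r p q]) (use p q \<open>p \<noteq> q\<close> in \<open>auto intro!: eq_vecI\<close>)
      then show ?thesis by simp
    next
      case False
      then have nj': "g q \<noteq> j'" if "q < r" for q using that by auto
      have "strict_mono_on {..<r} (g(p := j'))"
        unfolding strict_mono_on_def
      proof safe
        fix x y :: nat assume xy: "x < r" "y < r" "x < y"
        have "g x < g y" using *(2) xy by (auto simp: strict_mono_on_def)
        moreover have "g x \<noteq> j'" "g y \<noteq> j'" using nj' xy by auto
        ultimately show "(g(p := j')) x < (g(p := j')) y"
          using xy p j'(2) by auto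
      qed
      moreover have "g(p := j') ` {..<r} \<subseteq> J" using *(3) j'(1) by auto
      ultimately show ?thesis by (rule tpA)
    qed
    with lin tpA[OF *(2,3)] ab show ?thesis by simp
  qed
qed

text \<open>A column is built from its already replaced right neighbour, so the replacement runs
  from right to left.\<close>

lemma tp_on_sweep_down:
  assumes tp: "tp_on {..n} A" and n: "\<And>i. A' i n = A i n"
    and step: "\<And>j. j < n \<Longrightarrow> \<exists>a b. 0 \<le> a \<and> 0 \<le> b \<and> (\<forall>i. A' i j = a * A i j + b * A' i (Suc j))"
  shows "tp_on {..n} A'"
proof -
  have "tp_on {..n} (\<lambda>i j. if j < m then A i j else A' i j)" if "m \<le> n" for m
    using that
  proof (induction m rule: inc_induct)
    case base
    from tp show ?case by (rule tp_on_cong) (auto simp: n)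
  next
    case (step m)
    obtain a b where ab: "0 \<le> a" "0 \<le> b" "\<And>i. A' i m = a * A i m + b * A' i (Suc m)"
      using assms(3) step.hyps by blast
    show ?case
      by (rule tp_on_cong[OF tp_on_column_op[OF step.IH, of "Suc m" m a b]])
        (use step.hyps ab in auto)
  qed
  from this[of 0] show ?thesis by simp
qed

text \<open>Mirror image: the replaced left neighbour is used, so the replacement runs from left to
  right.\<close>

lemma tp_on_sweep_up:
  assumes tp: "tp_on {..n} A" and z: "\<And>i. A' i 0 = A i 0"
    and step: "\<And>j. j < n \<Longrightarrow> \<exists>a b. 0 \<le> a \<and> 0 \<le> b \<and>
                 (\<forall>i. A' i (Suc j) = a * A i (Suc j) + b * A' i j)"
  shows "tp_on {..n} A'"
proof -
  have "tp_on {..n} (\<lambda>i j. if j \<le> m then A' i j else A i j)" if "m \<le> n" for m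
    using that
  proof (induction m)
    case 0
    from tp show ?case by (rule tp_on_cong) (auto simp: z)
  next
    case (Suc m)
    obtain a b where ab: "0 \<le> a" "0 \<le> b" "\<And>i. A' i (Suc m) = a * A i (Suc m) + b * A' i m"
      using assms(3)[of m] Suc.prems by auto
    show ?case
      by (rule tp_on_cong[OF tp_on_column_op[OF Suc.IH, of m "Suc m" a b]])
        (use Suc.prems ab in auto)
  qed
  from this[of n] show ?thesis by (auto intro: tp_on_cong)
qed

text \<open>Here the right neighbour enters with its old value, so infinitely many columns are
  replaced from left to right.\<close>

lemma tp_on_bidiagonal:
  assumes tp: "tp_on UNIV A" and ab: "a \<ge> 0" "b \<ge> 0"
  shows "tp_on UNIV (\<lambda>i j. a * A i j + b * A i (Suc j))" (is "tp_on _ ?A")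
proof (rule tp_onI)
  fix r :: nat and f g :: "nat \<Rightarrow> nat"
  assume *: "strict_mono_on {..<r} f" "strict_mono_on {..<r} g" "g ` {..<r} \<subseteq> UNIV"
  have part: "tp_on UNIV (\<lambda>i j. if j < m then ?A i j else A i j)" for m
  proof (induction m)
    case 0
    from tp show ?case by simp
  next
    case (Suc m)
    show ?case
      by (rule tp_on_cong[OF tp_on_column_op[OF Suc.IH, of "Suc m" m a b]]) (use ab in auto)
  qed
  \<comment> \<open>A minor involves finitely many columns, so it is final after the first
    \<open>N\<close> replacements.\<close>
  obtain N where N: "\<And>p. p < r \<Longrightarrow> g p < N"
    using finite_nat_set_iff_bounded[of "g ` {..<r}"] by auto
  have "mat r r (\<lambda>(i, j). if g j < N then ?A (f i) (g j) else A (f i) (g j))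
      = mat r r (\<lambda>(i, j). ?A (f i) (g j))"
    using N by (intro eq_matI) auto
  with tp_onD[OF part[of N] *]
  show "det (mat r r (\<lambda>(i, j). ?A (f i) (g j))) \<ge> 0" by simp
qed

text \<open>A selected row whose index is not among the selected columns is zero. Otherwise both
  maps enumerate the same set increasingly, hence coincide, and the minor is 1.\<close>

lemma tp_on_identity: "tp_on UNIV (\<lambda>i j. if i = j then 1 else 0)"
proof (rule tp_onI)
  fix r :: nat and f g :: "nat \<Rightarrow> nat"
  assume *: "strict_mono_on {..<r} f" "strict_mono_on {..<r} g"
  let ?M = "mat r r (\<lambda>(i, j). if f i = g j then 1 else 0) :: real mat"
  show "det ?M \<ge> 0"
  proof (cases "f ` {..<r} \<subseteq> g ` {..<r}")
    case False
    then obtain p where p: "p < r" "f p \<notin> g ` {..<r}" by auto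
    have "det ?M = (\<Sum>j<r. ?M $$ (p, j) * cofactor ?M p j)"
      by (rule laplace_expansion_row) (use p in auto)
    also have "\<dots> = 0"
      using p by (intro sum.neutral) auto
    finally show ?thesis by simp
  next
    case True
    have inj: "inj_on f {..<r}" "inj_on g {..<r}"
      using * by (auto intro: strict_mono_on_imp_inj_on)
    have "f ` {..<r} = g ` {..<r}"
      using True inj by (intro card_subset_eq) (auto simp: card_image)
    then have "\<forall>p<r. f p = g p"
    proof (intro allI impI)
      fix p assume eq: "f ` {..<r} = g ` {..<r}" and "p < r"
      then show "f p = g p"
      proof (induction p rule: less_induct)
        case (less p)
        have "f p \<in> g ` {..<r}" using eq less.prems by blast
        then obtain q where q: "q < r" "g q = f p" by auto
        have "g p \<in> f ` {..<r}" using eq less.prems by blast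
        then obtain q' where q': "q' < r" "f q' = g p" by auto
        have "p \<le> q"
          using less.IH[of q] q less.prems inj(1)[THEN inj_onD, of q p] by force
        have "p \<le> q'"
          using less.IH[of q'] q' less.prems inj(2)[THEN inj_onD, of q' p] by force
        have "g p \<le> f p"
          using strict_mono_onD[OF *(2), of p q] q less.prems \<open>p \<le> q\<close> by (cases "p = q") auto
        moreover have "f p \<le> g p"
          using strict_mono_onD[OF *(1), of p q'] q' less.prems \<open>p \<le> q'\<close> by (cases "p = q'") auto
        ultimately show ?case by simp
      qed
    qed
    then have "?M = 1\<^sub>m r"
      using inj by (intro eq_matI) (auto simp: inj_on_def)
    then show ?thesis by simp
  qed
qed

section \<open>Even parts of power series and knot changes\<close>

definition even_part :: "'a :: zero fps \<Rightarrow> 'a fps" where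
  "even_part f = Abs_fps (\<lambda>n. f $ (2 * n))"

text \<open>This is \<open>\<Phi> u\<close>: the inner factor \<open>1 - fps_X\<close> takes
  differences, of which the even part keeps those at \<open>2 * r\<close>.\<close>

definition subdiv_series :: "nat \<Rightarrow> (nat \<Rightarrow> real) \<Rightarrow> real fps" where
  "subdiv_series d u = (1 - fps_X) ^ d * even_part ((1 - fps_X) * Abs_fps u)"

lemma even_part_mult:
  fixes f :: "'a :: comm_ring_1 fps"
  shows "even_part ((1 - fps_X ^ 2) * f) = (1 - fps_X) * even_part f"
proof (rule fps_ext)
  fix n
  show "even_part ((1 - fps_X ^ 2) * f) $ n = ((1 - fps_X) * even_part f) $ n"
    by (cases n) (auto simp: even_part_def algebra_simps fps_X_power_mult_nth fps_X_power_mult_right_nth)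
qed

text \<open>As \<open>(1 - x^2)^d = (1 + x)^d (1 - x)^d\<close>, the outer factor moves under the
  even part. For \<open>u t = t^j (t + 1)^(d - j)\<close> this is the form
  \<open>E_2[(1 + x)^d P]\<close> with the column polynomial \<open>P\<close> of the barycentric
  subdivision.\<close>

lemma subdiv_series_eq_even_part:
  "subdiv_series d u = even_part ((1 + fps_X) ^ d * ((1 - fps_X) ^ (d + 1) * Abs_fps u))"
proof -
  have *: "(1 - fps_X) ^ d * even_part f = even_part ((1 - fps_X ^ 2) ^ d * f)" for f :: "real fps"
    by (induction d) (simp_all add: even_part_mult mult.assoc)
  have "(1 - fps_X ^ 2 :: real fps) = (1 + fps_X) * (1 - fps_X)"
    by (simp add: algebra_simps power2_eq_square)
  then show ?thesis
    by (simp only: subdiv_series_def * power_mult_distrib power_add power_one_right mult.assoc)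
qed

lemma subdiv_series_lincomb:
  "subdiv_series d (\<lambda>t. a * u t + b * v t) =
     fps_const a * subdiv_series d u + fps_const b * subdiv_series d v"
proof -
  have "Abs_fps (\<lambda>t. a * u t + b * v t) = fps_const a * Abs_fps u + fps_const b * Abs_fps v"
    by (rule fps_ext) simp
  then have 1: "(1 - fps_X) * Abs_fps (\<lambda>t. a * u t + b * v t) =
      fps_const a * ((1 - fps_X) * Abs_fps u) + fps_const b * ((1 - fps_X) * Abs_fps v)"
    by (simp add: algebra_simps)
  have 2: "even_part (fps_const a * f + fps_const b * g) =
      fps_const a * even_part f + fps_const b * even_part g" for f g :: "real fps"
    by (rule fps_ext) (simp add: even_part_def)
  show ?thesis
    unfolding subdiv_series_def 1 2 by (simp add: distrib_left mult.left_commute)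
qed

text \<open>The generating function of these binomial coefficients is
  \<open>x^j / (1 - x)^(d + 1)\<close>, whose denominator cancels.\<close>

lemma subdiv_series_binomial:
  assumes "j \<le> d"
  shows "subdiv_series d (\<lambda>t. real ((t + d - j) choose d)) = even_part ((1 + fps_X) ^ d * fps_X ^ j)"
proof -
  have "inverse ((1 - fps_X) ^ (d + 1)) = Abs_fps (\<lambda>k. real ((d + k) choose d))"
    using one_minus_const_fps_X_neg_power'[of "d + 1" "1 :: real"]
      binomial_symmetric[of d "d + k" for k] by simp
  \<comment> \<open>For \<open>t < j\<close> the upper index drops below \<open>d\<close> and the
    coefficient vanishes; \<open>j \<le> d\<close> keeps the subtraction exact.\<close>
  moreover have "Abs_fps (\<lambda>t. real ((t + d - j) choose d)) =
      fps_X ^ j * Abs_fps (\<lambda>k. real ((d + k) choose d))"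
    using assms by (intro fps_ext) (auto simp: fps_X_power_mult_nth add_ac)
  moreover have "(1 - fps_X) ^ (d + 1) * inverse ((1 - fps_X :: real fps) ^ (d + 1)) = 1"
    by (intro inverse_mult_eq_1') (simp add: fps_nth_power_0)
  ultimately have "(1 - fps_X) ^ (d + 1) * Abs_fps (\<lambda>t. real ((t + d - j) choose d)) = fps_X ^ j"
    by (metis mult.commute mult.left_commute mult_1)
  then show ?thesis unfolding subdiv_series_eq_even_part by simp
qed

text \<open>A further factor \<open>1 + x\<close> adds to each column its right neighbour; the
  induction starts from the identity matrix.\<close>

lemma tp_on_toeplitz_binomial:
  "tp_on UNIV (\<lambda>i j. ((1 + fps_X :: real fps) ^ d * fps_X ^ j) $ i)"
proof (induction d)
  case 0
  show ?case using tp_on_identity by (rule tp_on_cong) (simp add: fps_X_power_nth)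
next
  case (Suc d)
  show ?case
    by (rule tp_on_cong[OF tp_on_bidiagonal[OF Suc.IH, of 1 1]])
      (simp_all add: distrib_right mult.assoc mult.left_commute[of fps_X] flip: fps_add_nth)
qed

section \<open>Moving the knots from the binomial basis to the target basis\<close>

lemma prod_shifted_eq_binomial:
  assumes "j \<le> d"
  shows "(\<Prod>k\<in>{j..<j + d}. real t + real d - real k) = fact d * real ((t + d - j) choose d)"
proof -
  have "(\<Prod>k\<in>{j..<j + d}. real t + real d - real k) = (\<Prod>i=0..<d. real (t + d - j) - real i)"
    by (rule prod.reindex_bij_witness[of _ "\<lambda>i. i + j" "\<lambda>k. k - j"])
      (use assms in \<open>auto simp: of_nat_diff\<close>)
  then show ?thesis by (simp add: binomial_gbinomial gbinomial_prod_rev)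
qed

text \<open>The functions \<open>t \<mapsto> \<Prod>k = j..<j + d. (t - x\<^bsub>k\<^esub>)\<close> for the knots \<open>x\<^bsub>k\<^esub> = k - d\<close>, \<open>k < 2 d\<close>. In
  \<open>left_basis d i\<close> the first \<open>i\<close> knots are moved to \<open>-1\<close>; in \<open>right_basis d n\<close> the first \<open>d\<close> knots
  are at \<open>-1\<close> and the last \<open>d - n\<close> ones at \<open>0\<close>.\<close>

definition left_basis :: "nat \<Rightarrow> nat \<Rightarrow> nat \<Rightarrow> nat \<Rightarrow> real" where
  "left_basis d i j t =
     (real t + 1) ^ (i - j) * (\<Prod>k\<in>{max i j..<j + d}. real t + real d - real k)"

definition right_basis :: "nat \<Rightarrow> nat \<Rightarrow> nat \<Rightarrow> nat \<Rightarrow> real" where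
  "right_basis d n j t =
     (real t + 1) ^ (d - j) * (\<Prod>k<min j n. real t - real k) * real t ^ (j - n)"

text \<open>Apart from the common factor \<open>C\<close>, the three functions are linear with roots
  -1, \<open>i - d\<close> and \<open>j\<close>. Since \<open>i - d \<le> -1 < j\<close>, the factor
  \<open>t + 1\<close> is a convex combination of the other two.\<close>

lemma left_basis_step:
  assumes "j \<le> i" "i < d"
  shows "left_basis d (Suc i) j t =
    (1 + real j) / (real d - real i + real j) * left_basis d i j t +
    (real d - real i - 1) / (real d - real i + real j) * left_basis d (Suc i) (Suc j) t"
proof -
  define C where "C = (real t + 1) ^ (i - j) * (\<Prod>k\<in>{Suc i..<j + d}. real t + real d - real k)"
  have 1: "left_basis d (Suc i) j t = (real t + 1) * C"
    using assms by (simp add: left_basis_def C_def Suc_diff_le max_def)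
  have 2: "left_basis d i j t = (real t + real d - real i) * C"
    using assms by (simp add: left_basis_def C_def max_def prod.atLeast_Suc_lessThan)
  have 3: "left_basis d (Suc i) (Suc j) t = (real t - real j) * C"
    using assms by (simp add: left_basis_def C_def max_def mult_ac)
  have "real t + 1 = (1 + real j) / (real d - real i + real j) * (real t + real d - real i) +
     (real d - real i - 1) / (real d - real i + real j) * (real t - real j)"
  proof -
    have "real d - real i + real j \<noteq> 0" using assms by simp
    then have "real t + 1 = ((1 + real j) * (real t + real d - real i) +
        (real d - real i - 1) * (real t - real j)) / (real d - real i + real j)"
      by (subst nonzero_eq_divide_eq) (simp_all add: algebra_simps)
    then show ?thesis by (simp only: times_divide_eq_left mult_1 flip: add_divide_distrib)
  qed
  then show ?thesis unfolding 1 2 3 by (metis distrib_right mult.assoc)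
qed

text \<open>The same with roots 0, \<open>n\<close> and -1: since \<open>-1 < 0 \<le> n\<close>, the
  factor \<open>t\<close> is a convex combination of \<open>t - n\<close> and
  \<open>t + 1\<close>.\<close>

lemma right_basis_step:
  assumes "n < j" "j \<le> d"
  shows "right_basis d n j t =
    1 / (real n + 1) * right_basis d (Suc n) j t + real n / (real n + 1) * right_basis d n (j - 1) t"
proof -
  define C where "C = (real t + 1) ^ (d - j) * (\<Prod>k<n. real t - real k) * real t ^ (j - Suc n)"
  have j: "j - n = Suc (j - Suc n)" "d - (j - 1) = Suc (d - j)" "j - 1 - n = j - Suc n"
    "min j n = n" "min j (Suc n) = Suc n" "min (j - 1) n = n"
    using assms by auto
  have 1: "right_basis d n j t = real t * C"
    unfolding right_basis_def C_def j by simp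
  have 2: "right_basis d (Suc n) j t = (real t - real n) * C"
    unfolding right_basis_def C_def j by simp
  have 3: "right_basis d n (j - 1) t = (real t + 1) * C"
    unfolding right_basis_def C_def j by simp
  have "real t = 1 / (real n + 1) * (real t - real n) + real n / (real n + 1) * (real t + 1)"
  proof -
    have "real t = ((real t - real n) + real n * (real t + 1)) / (real n + 1)"
      by (subst nonzero_eq_divide_eq) (simp_all add: algebra_simps)
    then show ?thesis by (simp only: times_divide_eq_left mult_1 flip: add_divide_distrib)
  qed
  then show ?thesis unfolding 1 2 3 by (metis distrib_right mult.assoc)
qed

lemma left_basis_final: "j \<le> d \<Longrightarrow> left_basis d d j t = right_basis d d j t"
proof -
  assume "j \<le> d"
  have "(\<Prod>k\<in>{d..<j + d}. real t + real d - real k) = (\<Prod>k<j. real t - real k)"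
    by (rule prod.reindex_bij_witness[of _ "\<lambda>i. i + d" "\<lambda>k. k - d"]) (auto simp: of_nat_diff)
  then show ?thesis
    using \<open>j \<le> d\<close> by (simp add: left_basis_def right_basis_def max_def min_def)
qed

text \<open>Each knot move is one sweep. The formula for column \<open>j\<close> uses the moved
  column \<open>j + 1\<close>, so the sweep descends from column \<open>d\<close>.\<close>

lemma tp_on_left_basis:
  assumes "i \<le> d"
  shows "tp_on {..d} (\<lambda>r j. subdiv_series d (left_basis d i j) $ r)"
  using assms
proof (induction i)
  case 0
  have "tp_on {..d} (\<lambda>r j. fact d * (((1 + fps_X :: real fps) ^ d * fps_X ^ j) $ (2 * r)))"
    by (rule tp_on_scale[OF tp_on_rows[OF tp_on_subset[OF tp_on_toeplitz_binomial]]])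
      (auto simp: strict_mono_def)
  then show ?case
  proof (rule tp_on_cong)
    fix r j assume "j \<in> {..d}"
    \<comment> \<open>The zero summand gives the multiple the shape of
      \<open>subdiv_series_lincomb\<close>.\<close>
    then have "left_basis d 0 j = (\<lambda>t. fact d * real ((t + d - j) choose d) + 0 * 0)"
      by (auto simp: left_basis_def prod_shifted_eq_binomial)
    then have "subdiv_series d (left_basis d 0 j) =
        fps_const (fact d) * even_part ((1 + fps_X) ^ d * fps_X ^ j)"
      using \<open>j \<in> {..d}\<close> by (simp only: subdiv_series_lincomb) (simp add: subdiv_series_binomial)
    then show "fact d * (((1 + fps_X :: real fps) ^ d * fps_X ^ j) $ (2 * r)) =
        subdiv_series d (left_basis d 0 j) $ r"
      by (simp add: even_part_def)
  qed
next
  case (Suc i)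
  then have IH: "tp_on {..d} (\<lambda>r j. subdiv_series d (left_basis d i j) $ r)" by simp
  \<comment> \<open>The product for such a column starts after knot \<open>i\<close>, so moving that
    knot has no effect; column \<open>d\<close> is always of this kind.\<close>
  have same: "left_basis d (Suc i) j = left_basis d i j" if "i < j" for j
    using that by (auto simp: left_basis_def max_def)
  show ?case
  proof (rule tp_on_sweep_down[OF IH])
    show "subdiv_series d (left_basis d (Suc i) d) $ r = subdiv_series d (left_basis d i d) $ r" for r
      using Suc.prems by (simp add: same)
  next
    fix j assume "j < d"
    show "\<exists>a b. 0 \<le> a \<and> 0 \<le> b \<and> (\<forall>r. subdiv_series d (left_basis d (Suc i) j) $ r =
            a * subdiv_series d (left_basis d i j) $ r +
            b * subdiv_series d (left_basis d (Suc i) (Suc j)) $ r)"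
    proof (cases "j \<le> i")
      case True
      have eq: "left_basis d (Suc i) j = (\<lambda>t.
          (1 + real j) / (real d - real i + real j) * left_basis d i j t +
          (real d - real i - 1) / (real d - real i + real j) * left_basis d (Suc i) (Suc j) t)"
        using True Suc.prems by (intro ext left_basis_step) auto
      show ?thesis
        by (rule exI[of _ "(1 + real j) / (real d - real i + real j)"],
            rule exI[of _ "(real d - real i - 1) / (real d - real i + real j)"],
            subst eq, subst subdiv_series_lincomb)
          (use Suc.prems in auto)
    next
      case False
      then show ?thesis by (intro exI[of _ 1] exI[of _ 0]) (simp add: same)
    qed
  qed
qed

text \<open>Now \<open>n\<close> descends from \<open>d\<close>, and column \<open>j\<close> uses
  the moved column \<open>j - 1\<close>, so each sweep ascends from column 0.\<close>

lemma tp_on_right_basis: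
  assumes "n \<le> d"
  shows "tp_on {..d} (\<lambda>r j. subdiv_series d (right_basis d n j) $ r)"
  using assms
proof (induction n rule: inc_induct)
  case base
  have "left_basis d d j = right_basis d d j" if "j \<le> d" for j
    using left_basis_final[OF that] by auto
  with tp_on_left_basis[of d d] show ?case by (auto intro: tp_on_cong)
next
  case (step n)
  have same: "right_basis d n j = right_basis d (Suc n) j" if "j \<le> n" for j
    using that by (auto simp: right_basis_def min_def)
  show ?case
  proof (rule tp_on_sweep_up[OF step.IH])
    show "subdiv_series d (right_basis d n 0) $ r = subdiv_series d (right_basis d (Suc n) 0) $ r" for r
      by (simp add: same)
  next
    fix j assume "j < d"
    show "\<exists>a b. 0 \<le> a \<and> 0 \<le> b \<and> (\<forall>r. subdiv_series d (right_basis d n (Suc j)) $ r =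
            a * subdiv_series d (right_basis d (Suc n) (Suc j)) $ r +
            b * subdiv_series d (right_basis d n j) $ r)"
    proof (cases "n < Suc j")
      case True
      have eq: "right_basis d n (Suc j) = (\<lambda>t.
          1 / (real n + 1) * right_basis d (Suc n) (Suc j) t +
          real n / (real n + 1) * right_basis d n j t)"
        using right_basis_step[OF True, of d] \<open>j < d\<close> by auto
      show ?thesis
        by (rule exI[of _ "1 / (real n + 1)"], rule exI[of _ "real n / (real n + 1)"],
            subst eq, subst subdiv_series_lincomb) auto
    next
      case False
      then show ?thesis by (intro exI[of _ 1] exI[of _ 0]) (simp add: same)
    qed
  qed
qed

section \<open>Total positivity of the explicit matrix\<close>

definition interval_matrix :: "nat \<Rightarrow> real mat" where
  "interval_matrix d = mat (d + 1) (d + 1)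
     (\<lambda>(i, j). subdiv_series d (\<lambda>t. real t ^ j * (real t + 1) ^ (d - j)) $ i)"

text \<open>\<open>pick\<close> enumerates an index set increasingly, so every minor is one of those
  in \<open>tp_on\<close>.\<close>

lemma totally_positive_mat:
  assumes "tp_on {..<m} A"
  shows "totally_positive (mat n m (\<lambda>(i, j). A i j))"
  unfolding totally_positive_def
proof (intro allI impI, elim conjE)
  fix I J :: "nat set"
  assume I: "I \<subseteq> {..<dim_row (mat n m (\<lambda>(i, j). A i j))}"
    and J: "J \<subseteq> {..<dim_col (mat n m (\<lambda>(i, j). A i j))}" and card: "card I = card J"
  have IJ: "{i. i < n \<and> i \<in> I} = I" "{j. j < m \<and> j \<in> J} = J" using I J by auto
  have pI: "pick I i < n" if "i < card I" for i
    using pick_in_set_le[OF that] I by auto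
  have pJ: "pick J j < m" if "j < card J" for j
    using pick_in_set_le[OF that] J by auto
  have "submatrix (mat n m (\<lambda>(i, j). A i j)) I J
      = mat (card J) (card J) (\<lambda>(i, j). A (pick I i) (pick J j))"
    unfolding submatrix_def using pI pJ by (intro eq_matI) (auto simp: IJ card)
  moreover have "det (mat (card J) (card J) (\<lambda>(i, j). A (pick I i) (pick J j))) \<ge> 0"
    by (rule tp_onD[OF assms])
      (use pJ in \<open>auto simp: strict_mono_on_def card[symmetric] intro: pick_mono_le\<close>)
  ultimately show "det (submatrix (mat n m (\<lambda>(i, j). A i j)) I J) \<ge> 0" by simp
qed

lemma totally_positive_interval_matrix: "totally_positive (interval_matrix d)"
proof -
  have "tp_on {..<d + 1} (\<lambda>i j. subdiv_series d (\<lambda>t. real t ^ j * (real t + 1) ^ (d - j)) $ i)"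
    using tp_on_right_basis[of 0 d]
    by (auto simp: right_basis_def[abs_def] mult.commute lessThan_Suc_atMost)
  then show ?thesis unfolding interval_matrix_def by (rule totally_positive_mat)
qed

section \<open>Chains and h-polynomials\<close>

text \<open>Here \<open>v p\<close> is the weight of the chains with largest element \<open>p\<close>; the induction removes a maximal
  element of \<open>P\<close>.\<close>

lemma sum_chains_eq:
  fixes v :: "'a set \<Rightarrow> 'b :: comm_semiring_1"
  assumes "finite P"
    and "\<And>p. p \<in> P \<Longrightarrow> v p = y * (1 + (\<Sum>q | q \<in> P \<and> q \<subset> p. v q))"
  shows "(\<Sum>C | subset.chain P C. y ^ card C) = 1 + (\<Sum>p\<in>P. v p)"
  using assms
proof (induction P rule: finite_psubset_induct)
  case (psubset P)
  show ?case
  proof (cases "P = {}")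
    case True
    then have "{C. subset.chain P C} = {{}}" by (auto simp: subset_chain_def)
    with True show ?thesis by simp
  next
    case False
    then obtain p where p: "p \<in> P" and max: "\<And>q. q \<in> P \<Longrightarrow> p \<subseteq> q \<Longrightarrow> q = p"
      using finite_has_maximal[OF psubset.hyps(1)] by metis
    define Q where "Q = {q \<in> P. q \<subset> p}"
    \<comment> \<open>Neither smaller poset loses elements below its members, so the recursion for
      \<open>v\<close> stays valid there.\<close>
    have down: "{q. q \<in> P \<and> q \<subset> x} = {q. q \<in> R \<and> q \<subset> x}"
      if R: "R = P - {p} \<or> R = Q" and x: "x \<in> R" for R x
    proof -
      have "q \<in> R" if q: "q \<in> P" "q \<subset> x" for q
      proof -
        have "q \<noteq> p" using max[of x] q x R unfolding Q_def by auto
        moreover have "q \<subset> p" if "x \<subset> p" using q(2) that by (rule psubset_trans)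
        ultimately show ?thesis using R x q(1) unfolding Q_def by blast
      qed
      moreover have "R \<subseteq> P" using R unfolding Q_def by blast
      ultimately show ?thesis by blast
    qed
    have IH: "(\<Sum>C | subset.chain R C. y ^ card C) = 1 + (\<Sum>p\<in>R. v p)"
      if "R = P - {p} \<or> R = Q" for R
    proof (rule psubset.IH)
      show R: "R \<subset> P" using that p unfolding Q_def by blast
      show "v x = y * (1 + (\<Sum>q | q \<in> R \<and> q \<subset> x. v q))" if "x \<in> R" for x
        unfolding down[OF \<open>R = P - {p} \<or> R = Q\<close> that, symmetric]
        by (rule psubset.prems) (use R that in blast)
    qed
    have fin: "finite {C. subset.chain R C}" if "R \<subseteq> P" for R
      by (rule finite_subset[of _ "Pow P"]) (use that psubset.hyps(1) in \<open>auto simp: subset_chain_def\<close>)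
    have split: "{C. subset.chain P C} =
        {C. subset.chain (P - {p}) C} \<union> insert p ` {C. subset.chain Q C}" (is "?L = ?R")
    proof
      show "?L \<subseteq> ?R"
      proof
        fix C assume "C \<in> ?L"
        then have C: "C \<subseteq> P" "\<And>X Y. X \<in> C \<Longrightarrow> Y \<in> C \<Longrightarrow> X \<subseteq> Y \<or> Y \<subseteq> X"
          by (auto simp: subset_chain_def)
        show "C \<in> ?R"
        proof (cases "p \<in> C")
          case True
          have "q \<in> Q" if "q \<in> C" "q \<noteq> p" for q
            using C(1) C(2)[OF that(1) True] that max[of q] unfolding Q_def by auto
          then have "subset.chain Q (C - {p})"
            by (intro subset_chain_def[THEN iffD2] conjI ballI subsetI) (simp_all add: C(2))
          moreover have "C = insert p (C - {p})" using True by (simp add: insert_absorb)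
          ultimately show ?thesis by (intro UnI2 image_eqI[of _ _ "C - {p}"] CollectI)
        next
          case False
          then have "subset.chain (P - {p}) C"
            using C by (intro subset_chain_def[THEN iffD2] conjI ballI) (simp_all add: subset_Diff_insert)
          then show ?thesis by simp
        qed
      qed
      have "subset.chain P C" if "subset.chain (P - {p}) C" for C
        using that by (simp add: subset_chain_def subset_Diff_insert)
      moreover have "subset.chain P (insert p C)" if "subset.chain Q C" for C
      proof -
        have "C \<subseteq> P" "\<And>q. q \<in> C \<Longrightarrow> q \<subseteq> p" "\<And>X Y. X \<in> C \<Longrightarrow> Y \<in> C \<Longrightarrow> X \<subseteq> Y \<or> Y \<subseteq> X"
          using that unfolding subset_chain_def Q_def by auto
        then show ?thesis using p unfolding subset_chain_def by auto
      qed
      ultimately show "?R \<subseteq> ?L" by auto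
    qed
    have pQ: "p \<notin> C" if "subset.chain Q C" for C using that by (auto simp: subset_chain_def Q_def)
    have inj: "inj_on (insert p) {C. subset.chain Q C}"
      using pQ by (auto simp: inj_on_def dest: insert_ident[THEN iffD1, rotated 2])
    have card: "card (insert p C) = Suc (card C)" if "subset.chain Q C" for C
    proof -
      have "finite C" using that psubset.hyps(1) finite_subset[of C P]
        by (auto simp: subset_chain_def Q_def)
      then show ?thesis using pQ[OF that] by simp
    qed
    have "(\<Sum>C | subset.chain P C. y ^ card C) =
        (\<Sum>C | subset.chain (P - {p}) C. y ^ card C) + (\<Sum>C\<in>insert p ` {C. subset.chain Q C}. y ^ card C)"
      unfolding split
      by (intro sum.union_disjoint fin finite_imageI) (auto simp: Q_def subset_chain_def)
    also have "(\<Sum>C\<in>insert p ` {C. subset.chain Q C}. y ^ card C) =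
        y * (\<Sum>C | subset.chain Q C. y ^ card C)"
      by (simp add: sum.reindex[OF inj] card sum_distrib_left)
    also have "\<dots> = v p"
      using IH[of Q] psubset.prems[OF p] by (simp add: Q_def)
    finally show ?thesis
      using IH[of "P - {p}"] p psubset.hyps(1) by (simp add: sum.remove[of P p] add_ac)
  qed
qed

section \<open>Binomial sums over intervals of sets\<close>

lemma sum_power_card_Pow:
  fixes c :: "'b :: comm_semiring_1"
  assumes "finite S"
  shows "(\<Sum>T\<in>Pow S. c ^ card T) = (c + 1) ^ card S"
  using assms
proof (induction S)
  case (insert x S)
  have inj: "inj_on (insert x) (Pow S)" using insert.hyps by (auto simp: inj_on_def)
  have "(\<Sum>T\<in>Pow (insert x S). c ^ card T) = (\<Sum>T\<in>Pow S. c ^ card T) + (\<Sum>T\<in>insert x ` Pow S. c ^ card T)"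
    unfolding Pow_insert using insert.hyps by (intro sum.union_disjoint) auto
  also have "(\<Sum>T\<in>insert x ` Pow S. c ^ card T) = (\<Sum>T\<in>Pow S. c * c ^ card T)"
    unfolding sum.reindex[OF inj] comp_def
  proof (rule sum.cong)
    fix T assume "T \<in> Pow S"
    then have "finite T" "x \<notin> T" using insert.hyps finite_subset by auto
    then show "c ^ card (insert x T) = c * c ^ card T" by simp
  qed simp
  finally show ?case using insert by (simp add: sum_distrib_left[symmetric] algebra_simps)
qed simp

lemma sum_power_card_interval_lower:
  fixes c :: "'b :: comm_semiring_1"
  assumes "finite B" "A \<subseteq> B"
  shows "(\<Sum>C\<in>{A..B}. c ^ card (C - A)) = (c + 1) ^ card (B - A)"
proof -
  have "(\<Sum>C\<in>{A..B}. c ^ card (C - A)) = (\<Sum>T\<in>Pow (B - A). c ^ card T)"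
    by (rule sum.reindex_bij_witness[of _ "\<lambda>T. T \<union> A" "\<lambda>C. C - A"])
      (use assms in \<open>auto intro!: arg_cong[where f = card]\<close>)
  then show ?thesis using sum_power_card_Pow[of "B - A" c] assms by simp
qed

lemma sum_power_card_interval_upper:
  fixes c :: "'b :: comm_semiring_1"
  assumes "finite B" "A \<subseteq> B"
  shows "(\<Sum>C\<in>{A..B}. c ^ card (B - C)) = (c + 1) ^ card (B - A)"
proof -
  have "(\<Sum>C\<in>{A..B}. c ^ card (B - C)) = (\<Sum>T\<in>Pow (B - A). c ^ card T)"
    by (rule sum.reindex_bij_witness[of _ "\<lambda>T. B - T" "\<lambda>C. B - C"])
      (use assms in \<open>auto intro!: arg_cong[where f = card]\<close>)
  then show ?thesis using sum_power_card_Pow[of "B - A" c] assms by simp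
qed

section \<open>h-polynomials as sums over faces\<close>

lemma sum_face_count:
  fixes \<phi> :: "nat \<Rightarrow> 'b :: comm_semiring_1"
  assumes "finite K" "\<And>F. F \<in> K \<Longrightarrow> card F \<le> d"
  shows "(\<Sum>i\<le>d. of_nat (face_count K (int i - 1)) * \<phi> i) = (\<Sum>F\<in>K. \<phi> (card F))"
proof -
  have "(\<Sum>i\<le>d. of_nat (face_count K (int i - 1)) * \<phi> i) = (\<Sum>i\<le>d. \<Sum>F | F \<in> K \<and> card F = i. \<phi> (card F))"
    by (rule sum.cong) (auto simp: face_count_def face_dim_def)
  also have "\<dots> = (\<Sum>F\<in>K. \<phi> (card F))"
    using sum.group[of K "{..d}" card "\<lambda>F. \<phi> (card F)"] assms by auto
  finally show ?thesis .
qed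

lemma card_face_le_dim:
  assumes "simplicial_complex K" "F \<in> K" "complex_dim K = int d - 1"
  shows "card F \<le> d"
proof -
  have "face_dim F \<le> complex_dim K"
    using assms unfolding complex_dim_def simplicial_complex_def by (intro Max_ge) auto
  then show ?thesis using assms(3) by (simp add: face_dim_def)
qed

lemma h_polynomial_eq:
  assumes "simplicial_complex K" "complex_dim K = int d - 1"
  shows "h_polynomial K = (\<Sum>F\<in>K. [:0, 1:] ^ card F * [:1, -1:] ^ (d - card F))"
proof -
  have "h_polynomial K =
      (\<Sum>i\<le>d. of_nat (face_count K (int i - 1)) * ([:0, 1:] ^ i * [:1, -1:] ^ (d - i)))"
    using assms(2) by (simp add: h_polynomial_def of_nat_poly)
  also have "\<dots> = (\<Sum>F\<in>K. [:0, 1:] ^ card F * [:1, -1:] ^ (d - card F))"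
    by (rule sum_face_count) (use assms card_face_le_dim in \<open>auto simp: simplicial_complex_def\<close>)
  finally show ?thesis .
qed

lemma degree_h_polynomial_le:
  assumes "simplicial_complex K" "complex_dim K = int d - 1"
  shows "degree (h_polynomial K) \<le> d"
  unfolding h_polynomial_eq[OF assms]
proof (rule degree_sum_le)
  show "finite K" using assms by (simp add: simplicial_complex_def)
  fix F assume "F \<in> K"
  then have F: "card F \<le> d" using card_face_le_dim assms by blast
  have "degree ([:0, 1:] ^ card F * [:1, -1:] ^ (d - card F) :: real poly) \<le>
      degree ([:0, 1:] ^ card F :: real poly) + degree ([:1, -1:] ^ (d - card F) :: real poly)"
    by (rule degree_mult_le)
  also have "\<dots> \<le> d"
    using F by (simp add: degree_power_eq)
  finally show "degree ([:0, 1:] ^ card F * [:1, -1:] ^ (d - card F) :: real poly) \<le> d" .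
qed

text \<open>The h-polynomial is evaluated at \<open>x = t / (t + 1)\<close>, where
  \<open>1 - x = 1 / (t + 1)\<close>; the factor \<open>(t + 1)^d\<close> clears
  denominators.\<close>

lemma sum_h_polynomial_coeff:
  assumes K: "simplicial_complex K" "complex_dim K = int d - 1"
  shows "(\<Sum>j\<le>d. coeff (h_polynomial K) j * (real t ^ j * (real t + 1) ^ (d - j))) = (\<Sum>F\<in>K. real t ^ card F)"
proof -
  let ?s = "real t + 1"
  have s: "?s > 0" by simp
  have pow: "?s ^ d * (real t / ?s) ^ j = real t ^ j * ?s ^ (d - j)" if "j \<le> d" for j
    using that s by (simp add: power_divide power_diff)
  have "(\<Sum>j\<le>d. coeff (h_polynomial K) j * (real t ^ j * ?s ^ (d - j))) =
      ?s ^ d * (\<Sum>j\<le>d. coeff (h_polynomial K) j * (real t / ?s) ^ j)"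
    unfolding sum_distrib_left by (rule sum.cong) (simp_all flip: pow)
  also have "(\<Sum>j\<le>d. coeff (h_polynomial K) j * (real t / ?s) ^ j) = poly (h_polynomial K) (real t / ?s)"
    unfolding poly_altdef using degree_h_polynomial_le[OF K]
    by (intro sum.mono_neutral_right) (auto simp: coeff_eq_0)
  also have "?s ^ d * \<dots> = (\<Sum>F\<in>K. real t ^ card F)"
    unfolding h_polynomial_eq[OF K] poly_sum sum_distrib_left
  proof (rule sum.cong)
    fix F assume "F \<in> K"
    then have F: "card F \<le> d" using card_face_le_dim K by blast
    have "1 - real t / ?s = 1 / ?s" using s by (simp add: field_simps)
    then have "poly ([:0, 1:] ^ card F * [:1, -1:] ^ (d - card F)) (real t / ?s) =
        (real t / ?s) ^ card F * (1 / ?s) ^ (d - card F)" by simp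
    then show "?s ^ d * poly ([:0, 1:] ^ card F * [:1, -1:] ^ (d - card F)) (real t / ?s) = real t ^ card F"
      using F s by (simp add: power_divide power_diff del: poly_mult poly_power)
  qed simp
  finally show ?thesis .
qed

text \<open>Taking out \<open>(1 - x)^d\<close> leaves each face the weight
  \<open>(x / (1 - x))^k\<close>. For a chain of \<open>k\<close> intervals this counts, by length,
  the multichains with exactly these members.\<close>

lemma fps_of_h_polynomial:
  assumes K: "simplicial_complex K" "complex_dim K = int d - 1"
  shows "fps_of_poly (h_polynomial K) =
    (1 - fps_X) ^ d * (\<Sum>F\<in>K. (fps_X * inverse (1 - fps_X)) ^ card F)"
  unfolding h_polynomial_eq[OF K] fps_of_poly_sum sum_distrib_left
proof (rule sum.cong)
  fix F assume "F \<in> K"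
  then have F: "card F \<le> d" using card_face_le_dim K by blast
  have inv: "(1 - fps_X) * inverse (1 - fps_X :: real fps) = 1"
    by (intro inverse_mult_eq_1') simp
  have "(1 - fps_X) ^ d * (fps_X * inverse (1 - fps_X)) ^ card F =
      fps_X ^ card F * (1 - fps_X) ^ (d - card F) * ((1 - fps_X) * inverse (1 - fps_X :: real fps)) ^ card F"
    using F by (simp add: power_mult_distrib mult_ac flip: power_add)
  then show "fps_of_poly ([:0, 1:] ^ card F * [:1, -1:] ^ (d - card F)) =
      (1 - fps_X) ^ d * (fps_X * inverse (1 - fps_X :: real fps)) ^ card F"
    by (simp add: inv fps_of_poly_mult fps_of_poly_power fps_of_poly_pCons)
qed simp

section \<open>Counting chains of intervals\<close>

text \<open>For an interval, union and intersection are its endpoints, so the rank needs no choice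
  of them.\<close>

definition interval_rank :: "'a set set \<Rightarrow> nat" where
  "interval_rank p = card (\<Union>p - \<Inter>p)"

lemma interval_rank_Icc [simp]: "A \<subseteq> B \<Longrightarrow> interval_rank {A..B} = card (B - A)"
proof -
  assume "A \<subseteq> B"
  then have "\<Union>{A..B} = B" "\<Inter>{A..B} = A" by auto
  then show ?thesis by (simp add: interval_rank_def)
qed

lemma finite_face_intervals: "finite K \<Longrightarrow> finite (face_intervals K)"
  by (rule finite_subset[of _ "(\<lambda>(A, B). {A..B}) ` (K \<times> K)"]) (auto simp: face_intervals_def)

lemma finite_Icc_set: "finite B \<Longrightarrow> finite {A..B :: 'a set}"
  by (rule finite_subset[of _ "Pow B"]) auto

lemma face_intervals_below:
  assumes K: "simplicial_complex K" and AB: "A \<in> K" "B \<in> K" "A \<noteq> {}" "A \<subseteq> B"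
  shows "{q \<in> face_intervals K. q \<subseteq> {A..B}} = (\<lambda>(A', B'). {A'..B'}) ` (SIGMA A':{A..B}. {A'..B})"
proof -
  have sub: "C \<in> K" if "C \<subseteq> B" for C using K that AB(2) by (auto simp: simplicial_complex_def)
  show ?thesis
  proof (intro equalityI subsetI)
    fix q assume "q \<in> {q \<in> face_intervals K. q \<subseteq> {A..B}}"
    then obtain A' B' where "q = {A'..B'}" "A' \<subseteq> B'" "{A'..B'} \<subseteq> {A..B}"
      by (auto simp: face_intervals_def)
    then show "q \<in> (\<lambda>(A', B'). {A'..B'}) ` (SIGMA A':{A..B}. {A'..B})"
      by (auto intro!: image_eqI[of _ _ "(A', B')"])
  next
    fix q assume "q \<in> (\<lambda>(A', B'). {A'..B'}) ` (SIGMA A':{A..B}. {A'..B})"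
    then obtain A' B' where q: "q = {A'..B'}" "A \<subseteq> A'" "A' \<subseteq> B'" "B' \<subseteq> B" by auto
    then have "A' \<in> K" "B' \<in> K" "A' \<noteq> {}" using sub AB(3) by auto
    then show "q \<in> {q \<in> face_intervals K. q \<subseteq> {A..B}}"
      using q by (auto simp: face_intervals_def)
  qed
qed

text \<open>The coefficient of \<open>x^r\<close> counts the multichains of \<open>r\<close> intervals whose top is a given interval
  \<open>{A..B}\<close> with \<open>card (B - A) = n\<close>.\<close>

definition multichain_series :: "nat \<Rightarrow> real fps" where
  "multichain_series n = Abs_fps (\<lambda>r. if r = 0 then 0 else (2 * real r - 1) ^ n)"

text \<open>Removing the top \<open>{A..B}\<close> leaves a multichain with top
  \<open>{A'..B'}\<close> inside it, or nothing. Each of the two sums raises the base by one, from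
  \<open>2 (r - 1) - 1\<close> to \<open>2 r - 1\<close>.\<close>

lemma sum_multichain_series_interval:
  assumes "finite B" "A \<subseteq> B"
  shows "fps_X * (1 + (\<Sum>A'\<in>{A..B}. \<Sum>B'\<in>{A'..B}. multichain_series (card (B' - A')))) =
    multichain_series (card (B - A))"
proof (rule fps_ext)
  fix r
  have "(\<Sum>A'\<in>{A..B}. \<Sum>B'\<in>{A'..B}. c ^ card (B' - A')) = (c + 1 + 1) ^ card (B - A)" for c :: real
    using assms by (simp add: sum_power_card_interval_lower sum_power_card_interval_upper)
  note * = this[of "2 * real (r - 1) - 1"]
  show "(fps_X * (1 + (\<Sum>A'\<in>{A..B}. \<Sum>B'\<in>{A'..B}. multichain_series (card (B' - A'))))) $ r =
      multichain_series (card (B - A)) $ r"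
  \<comment> \<open>The series has coefficient 0 at 0, so for \<open>r = 1\<close> only the summand
    1 contributes: the empty multichain.\<close>
  proof (cases "r \<le> 1")
    case True
    then consider "r = 0" | "r = 1" by linarith
    then show ?thesis by cases (auto simp: multichain_series_def fps_sum_nth)
  next
    case False
    then have "2 * real r - 1 = 2 * real (r - 1) - 1 + 1 + 1" by (simp add: of_nat_diff)
    then show ?thesis using * False by (simp add: multichain_series_def fps_sum_nth)
  qed
qed

lemma inj_on_interval: "inj_on (\<lambda>(A, B). {A..B}) {(A, B). A \<subseteq> (B :: 'a set)}"
  by (auto simp: inj_on_def Icc_eq_Icc)

lemma sum_interval_subdivision:
  assumes K: "simplicial_complex K"
  shows "(\<Sum>C\<in>interval_subdivision K. (fps_X * inverse (1 - fps_X)) ^ card C) =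
    1 + (\<Sum>p\<in>face_intervals K. multichain_series (interval_rank p))"
  unfolding interval_subdivision_def
proof (rule sum_chains_eq)
  have fin: "finite (face_intervals K)"
    using K by (intro finite_face_intervals) (simp add: simplicial_complex_def)
  then show "finite (face_intervals K)" .
  fix p assume p: "p \<in> face_intervals K"
  then obtain A B where AB: "A \<in> K" "B \<in> K" "A \<noteq> {}" "A \<subseteq> B" "p = {A..B}"
    by (auto simp: face_intervals_def)
  have finB: "finite B" using K AB by (auto simp: simplicial_complex_def)
  let ?S = "\<Sum>q | q \<in> face_intervals K \<and> q \<subset> p. multichain_series (interval_rank q)"
  have "(\<Sum>q | q \<in> face_intervals K \<and> q \<subseteq> p. multichain_series (interval_rank q)) =
      (\<Sum>A'\<in>{A..B}. \<Sum>B'\<in>{A'..B}. multichain_series (card (B' - A')))"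
  proof -
    have inj: "inj_on (\<lambda>(A, B). {A..B}) (SIGMA A':{A..B}. {A'..B})"
      by (rule inj_on_subset[OF inj_on_interval]) auto
    have "(\<Sum>A'\<in>{A..B}. \<Sum>B'\<in>{A'..B}. multichain_series (card (B' - A'))) =
        (\<Sum>(A', B')\<in>(SIGMA A':{A..B}. {A'..B}). multichain_series (card (B' - A')))"
      by (rule sum.Sigma) (simp_all add: finite_Icc_set finB)
    then show ?thesis
      unfolding AB(5) face_intervals_below[OF K AB(1-4)] sum.reindex[OF inj]
      by (auto intro!: sum.cong)
  qed
  moreover have "{q. q \<in> face_intervals K \<and> q \<subseteq> p} = insert p {q. q \<in> face_intervals K \<and> q \<subset> p}"
    using p by auto
  ultimately have "multichain_series (interval_rank p) =
      fps_X * (1 + (multichain_series (interval_rank p) + ?S))"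
    using sum_multichain_series_interval[OF finB AB(4)] AB fin by simp
  \<comment> \<open>The term \<open>q = p\<close>, a repetition of the top, moves to the left. This
    turns \<open>x\<close> into \<open>y = x / (1 - x)\<close>, as the recursion over strictly
    smaller intervals requires.\<close>
  then have 1: "(1 - fps_X) * multichain_series (interval_rank p) = fps_X * (1 + ?S)"
    by (simp add: algebra_simps)
  have inv: "inverse (1 - fps_X) * (1 - fps_X :: real fps) = 1"
    by (intro inverse_mult_eq_1) simp
  have "multichain_series (interval_rank p) =
      inverse (1 - fps_X) * ((1 - fps_X) * multichain_series (interval_rank p))"
    by (simp only: inv mult_1 flip: mult.assoc)
  then show "multichain_series (interval_rank p) =
      fps_X * inverse (1 - fps_X) * (1 + ?S)"
    unfolding 1 by (simp only: mult_ac)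
qed

text \<open>Intervals are grouped by their upper end \<open>B\<close>. With
  \<open>k = card B\<close>, the nonempty lower ends contribute
  \<open>(2 r)^k - (2 r - 1)^k\<close>, a difference of consecutive values of
  \<open>t^k\<close>.\<close>

lemma sum_face_intervals:
  assumes K: "simplicial_complex K"
  shows "1 + (\<Sum>p\<in>face_intervals K. multichain_series (interval_rank p)) =
    even_part ((1 - fps_X) * Abs_fps (\<lambda>t. \<Sum>F\<in>K. real t ^ card F))"
proof (rule fps_ext)
  fix r
  have finK: "finite K" and finF: "\<And>F. F \<in> K \<Longrightarrow> finite F" and sub: "\<And>F G. F \<in> K \<Longrightarrow> G \<subseteq> F \<Longrightarrow> G \<in> K"
    and emp: "{} \<in> K"
    using K by (auto simp: simplicial_complex_def)
  have eq: "face_intervals K = (\<lambda>(B, A). {A..B}) ` (SIGMA B:K. {{}..B} - {{}})"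
  proof (intro equalityI subsetI)
    fix p assume "p \<in> face_intervals K"
    then obtain A B where "p = {A..B}" "B \<in> K" "A \<noteq> {}" "A \<subseteq> B"
      by (auto simp: face_intervals_def)
    then show "p \<in> (\<lambda>(B, A). {A..B}) ` (SIGMA B:K. {{}..B} - {{}})"
      by (intro image_eqI[of _ _ "(B, A)"]) auto
  next
    fix p assume "p \<in> (\<lambda>(B, A). {A..B}) ` (SIGMA B:K. {{}..B} - {{}})"
    then obtain z where "z \<in> (SIGMA B:K. {{}..B} - {{}})" "p = (case z of (B, A) \<Rightarrow> {A..B})"
      by blast
    moreover obtain B A where "z = (B, A)" by (cases z)
    ultimately have "p = {A..B}" "(B, A) \<in> (SIGMA B:K. {{}..B} - {{}})" by simp_all
    then have "p = {A..B}" "B \<in> K" "A \<noteq> {}" "A \<subseteq> B" by auto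
    then show "p \<in> face_intervals K" using sub[of B A] by (auto simp: face_intervals_def)
  qed
  have inj: "inj_on (\<lambda>(B, A). {A..B}) (SIGMA B:K. {{}..B} - {{}})"
    by (auto simp: inj_on_def Icc_eq_Icc)
  have *: "(\<Sum>p\<in>face_intervals K. \<phi> (interval_rank p)) =
      (\<Sum>B\<in>K. \<Sum>A\<in>{{}..B} - {{}}. \<phi> (card (B - A)))" for \<phi> :: "nat \<Rightarrow> real"
  proof -
    have "(\<Sum>B\<in>K. \<Sum>A\<in>{{}..B} - {{}}. \<phi> (card (B - A))) =
        (\<Sum>(B, A)\<in>(SIGMA B:K. {{}..B} - {{}}). \<phi> (card (B - A)))"
      by (rule sum.Sigma) (simp_all add: finite_Icc_set finK finF)
    then show ?thesis
      unfolding eq sum.reindex[OF inj] by (auto intro!: sum.cong)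
  qed
  have inner: "(\<Sum>A\<in>{{}..B} - {{}}. c ^ card (B - A)) = (c + 1) ^ card B - c ^ card B"
    if "B \<in> K" for B and c :: real
    using sum_power_card_interval_upper[of B "{}" c] finF[OF that]
    by (simp add: sum_diff1 finite_Icc_set)
  show "(1 + (\<Sum>p\<in>face_intervals K. multichain_series (interval_rank p))) $ r =
      even_part ((1 - fps_X) * Abs_fps (\<lambda>t. \<Sum>F\<in>K. real t ^ card F)) $ r"
  proof (cases "r = 0")
    case True
    \<comment> \<open>By \<open>0 ^ 0 = 1\<close> only the empty face remains, matching the empty
      multichain.\<close>
    have "(\<Sum>F\<in>K. 0 ^ card F :: real) = (\<Sum>F\<in>K. if F = {} then 1 else 0)"
      by (rule sum.cong) (use finF in \<open>auto simp: power_0_left\<close>)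
    also have "\<dots> = 1" using finK emp by simp
    finally show ?thesis
      using True by (simp add: even_part_def multichain_series_def fps_sum_nth)
  next
    case False
    then have r: "2 * real r - 1 = real (2 * r - 1)" by (simp add: of_nat_diff)
    have "(1 + (\<Sum>p\<in>face_intervals K. multichain_series (interval_rank p))) $ r =
        (\<Sum>p\<in>face_intervals K. (2 * real r - 1) ^ interval_rank p)"
      using False by (simp add: fps_sum_nth multichain_series_def)
    also have "\<dots> = (\<Sum>B\<in>K. (2 * real r) ^ card B - (2 * real r - 1) ^ card B)"
      unfolding * by (rule sum.cong) (simp_all add: inner)
    finally show ?thesis
      using False by (simp add: even_part_def left_diff_distrib sum_subtractf r del: of_nat_diff)
  qed
qed

section \<open>Dimension of the subdivision\<close>

lemma interval_rank_strict_mono: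
  assumes K: "simplicial_complex K" and pq: "p \<in> face_intervals K" "q \<in> face_intervals K" "q \<subset> p"
  shows "interval_rank q < interval_rank p"
proof -
  obtain A B A' B' where *: "p = {A..B}" "q = {A'..B'}" "A \<subseteq> B" "A' \<subseteq> B'" "B \<in> K"
    using pq by (auto simp: face_intervals_def)
  then have "A \<subseteq> A'" "B' \<subseteq> B" "\<not> (A = A' \<and> B = B')" using pq(3) by auto
  then have "B' - A' \<subset> B - A" using * by blast
  moreover have "finite B" using * K by (auto simp: simplicial_complex_def)
  ultimately show ?thesis using * by (simp add: psubset_card_mono)
qed

lemma complex_dim_eqI:
  assumes "simplicial_complex K" "F \<in> K" "card F = d" "\<And>F. F \<in> K \<Longrightarrow> card F \<le> d"
  shows "complex_dim K = int d - 1"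
  unfolding complex_dim_def
proof (rule Max_eqI)
  show "finite (face_dim ` K)" using assms(1) by (simp add: simplicial_complex_def)
  show "y \<le> int d - 1" if "y \<in> face_dim ` K" for y
    using that by (auto simp: face_dim_def dest!: assms(4))
  show "int d - 1 \<in> face_dim ` K"
    using assms(2,3) by (auto simp: face_dim_def intro!: image_eqI[of _ _ F])
qed

text \<open>Ranks along a chain are distinct, and below \<open>d\<close> because lower ends are
  nonempty. Conversely, a vertex as common lower end and a flag of faces up to a facet give
  \<open>d\<close> nested intervals.\<close>

lemma complex_dim_interval_subdivision:
  assumes K: "simplicial_complex K" "complex_dim K = int d - 1" and d: "d \<ge> 1"
  shows "complex_dim (interval_subdivision K) = int d - 1"
proof -
  have K': "simplicial_complex (interval_subdivision K)"
    using K(1) by (rule simplicial_complex_interval_subdivision)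
  have le: "card C \<le> d" if "C \<in> interval_subdivision K" for C
  proof -
    have C: "C \<subseteq> face_intervals K" "\<And>p q. p \<in> C \<Longrightarrow> q \<in> C \<Longrightarrow> p \<subseteq> q \<or> q \<subseteq> p"
      using that by (auto simp: interval_subdivision_def subset_chain_def)
    have "inj_on interval_rank C"
    proof (rule inj_onI, rule ccontr)
      fix p q assume pq: "p \<in> C" "q \<in> C" "interval_rank p = interval_rank q" "p \<noteq> q"
      then have "p \<subset> q \<or> q \<subset> p" using C(2) by blast
      then show False
        using interval_rank_strict_mono[OF K(1), of p q] interval_rank_strict_mono[OF K(1), of q p] C(1) pq
          by auto
    qed
    moreover have "interval_rank ` C \<subseteq> {..<d}"
    proof (intro image_subsetI)
      fix p assume "p \<in> C"
      then have "p \<in> face_intervals K" using C(1) by blast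
      then obtain A B where AB: "p = {A..B}" "A \<subseteq> B" "A \<noteq> {}" "B \<in> K"
        by (auto simp: face_intervals_def)
      have "finite B" using K(1) AB(4) by (auto simp: simplicial_complex_def)
      then have "card (B - A) < card B" using AB by (intro psubset_card_mono) auto
      also have "card B \<le> d" using card_face_le_dim K AB(4) by blast
      finally show "interval_rank p \<in> {..<d}" using AB by simp
    qed
    ultimately show ?thesis using card_inj_on_le[of interval_rank C "{..<d}"] by simp
  qed
  have "complex_dim K \<in> face_dim ` K"
    unfolding complex_dim_def using K(1) by (intro Max_in) (auto simp: simplicial_complex_def)
  then obtain F where F: "F \<in> K" "card F = d"
    using K(2) by (auto simp: face_dim_def)
  have "finite F" using F(1) K(1) by (auto simp: simplicial_complex_def)
  then obtain xs where xs: "set xs = F" "distinct xs" using finite_distinct_list by blast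
  have len: "length xs = d" using xs F(2) distinct_card[of xs] by simp
  define B where "B i = set (take (Suc i) xs)" for i
  define a where "a = xs ! 0"
  define C where "C = (\<lambda>i. {{a}..B i}) ` {..<d}"
  have aB: "{a} \<subseteq> B i" for i
    using len d unfolding a_def B_def by (cases xs) auto
  have cardB: "card (B i) = Suc i" if "i < d" for i
    unfolding B_def using that len xs(2) by (subst distinct_card) auto
  have mono: "B i \<subseteq> B j" if "i \<le> j" for i j
    unfolding B_def using that by (intro set_take_subset_set_take) simp
  have BF: "B i \<subseteq> F" for i unfolding B_def xs(1)[symmetric] by (rule set_take_subset)
  have down: "G \<in> K" if "G \<subseteq> F" for G using K(1) F(1) that by (auto simp: simplicial_complex_def)
  have "C \<subseteq> face_intervals K"
  proof
    fix p assume "p \<in> C"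
    then obtain i where "p = {{a}..B i}" by (auto simp: C_def)
    moreover have "{a} \<in> K" using aB[of i] BF[of i] by (intro down) blast
    moreover have "B i \<in> K" using BF[of i] by (rule down)
    ultimately show "p \<in> face_intervals K" using aB[of i] unfolding face_intervals_def by auto
  qed
  moreover have "p \<subseteq> q \<or> q \<subseteq> p" if pq: "p \<in> C" "q \<in> C" for p q
  proof -
    obtain i j where ij: "p = {{a}..B i}" "q = {{a}..B j}" using pq by (auto simp: C_def)
    show ?thesis using mono[of i j] mono[of j i] unfolding ij by (cases "i \<le> j") auto
  qed
  ultimately have C: "C \<in> interval_subdivision K"
    by (auto simp: interval_subdivision_def subset_chain_def)
  have "inj_on (\<lambda>i. {{a}..B i}) {..<d}"
  proof (rule inj_onI)
    fix i j assume ij: "i \<in> {..<d}" "j \<in> {..<d}" "{{a}..B i} = {{a}..B j}"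
    then have "B i = B j" using aB[of i] unfolding Icc_eq_Icc by blast
    then have "Suc i = Suc j" using cardB[of i] cardB[of j] ij(1,2) by (metis lessThan_iff)
    then show "i = j" by simp
  qed
  then have "card C = d" by (simp add: C_def card_image)
  with K' C show ?thesis using le by (rule complex_dim_eqI)
qed

section \<open>Existence of the transformation matrix\<close>

lemma subdiv_series_sum:
  assumes "finite S"
  shows "subdiv_series d (\<lambda>t. \<Sum>j\<in>S. c j * u j t) = (\<Sum>j\<in>S. fps_const (c j) * subdiv_series d (u j))"
  using assms
proof (induction S)
  case empty
  show ?case using subdiv_series_lincomb[of d 0 "\<lambda>_. 0" 0 "\<lambda>_. 0"] by simp
next
  case (insert x S)
  then show ?case
    using subdiv_series_lincomb[of d "c x" "u x" 1 "\<lambda>t. \<Sum>j\<in>S. c j * u j t"] by simp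
qed

text \<open>The subdivision has h-polynomial \<open>\<Phi> u\<close> with \<open>u\<close> the sum
  of \<open>t^card F\<close> over the faces. Expanding \<open>u\<close> by the h-vector of
  \<open>K\<close>, linearity of \<open>\<Phi>\<close> yields the matrix product.\<close>

lemma is_interval_h_matrix_interval_matrix:
  assumes d: "d \<ge> 1"
  shows "is_interval_h_matrix d (interval_matrix d)"
  unfolding is_interval_h_matrix_def
proof (intro conjI allI impI, goal_cases)
  case 1
  show ?case by (simp add: interval_matrix_def)
next
  case (2 K)
  then have K: "simplicial_complex K" "complex_dim K = int d - 1" by auto
  note K' = simplicial_complex_interval_subdivision[OF K(1)]
  note dim' = complex_dim_interval_subdivision[OF K d]
  have "fps_of_poly (h_polynomial (interval_subdivision K)) =
      subdiv_series d (\<lambda>t. \<Sum>F\<in>K. real t ^ card F)"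
    by (simp add: fps_of_h_polynomial[OF K' dim'] sum_interval_subdivision[OF K(1)]
        sum_face_intervals[OF K(1)] subdiv_series_def)
  also have "\<dots> = (\<Sum>j\<le>d. fps_const (coeff (h_polynomial K) j) *
      subdiv_series d (\<lambda>t. real t ^ j * (real t + 1) ^ (d - j)))"
    by (subst subdiv_series_sum[symmetric]) (simp_all add: sum_h_polynomial_coeff[OF K])
  finally have "coeff (h_polynomial (interval_subdivision K)) i =
      (\<Sum>j\<le>d. coeff (h_polynomial K) j *
         subdiv_series d (\<lambda>t. real t ^ j * (real t + 1) ^ (d - j)) $ i)" for i
    by (simp add: fps_sum_nth flip: fps_of_poly_nth)
  then show ?case
    by (intro eq_vecI)
      (auto simp: h_vector_def K(2) dim' interval_matrix_def scalar_prod_def mult.commute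
        atLeast0LessThan lessThan_Suc_atMost intro!: sum.cong)
qed

section \<open>Uniqueness of the transformation matrix\<close>

text \<open>Adding a single face of cardinality \<open>m\<close> to a complex adds \<open>x^m (1 - x)^(d - m)\<close> to its
  h-polynomial, so the functional vanishes on all these polynomials, which span.\<close>

lemma functional_vanishing_on_h_polynomials:
  fixes a :: "nat \<Rightarrow> real"
  assumes d: "d \<ge> 1"
    and zero: "\<And>K :: nat set set. simplicial_complex K \<Longrightarrow> complex_dim K = int d - 1 \<Longrightarrow>
           (\<Sum>j\<le>d. a j * coeff (h_polynomial K) j) = 0"
    and j: "j \<le> d"
  shows "a j = 0"
proof -
  define L where "L p = (\<Sum>j\<le>d. a j * coeff p j)" for p :: "real poly"
  define b where "b k = L ([:0, 1:] ^ k * [:1, -1:] ^ (d - k))" for k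
  have L_sum: "L (sum f S) = (\<Sum>x\<in>S. L (f x))" for f :: "'c \<Rightarrow> real poly" and S
    unfolding L_def coeff_sum sum_distrib_left by (rule sum.swap)
  have L_smult: "L (smult c p) = c * L p" for c p
    by (simp add: L_def sum_distrib_left mult_ac)
  have sum_b: "(\<Sum>F\<in>K. b (card F)) = 0"
    if "simplicial_complex K" "{..<d} \<in> K" "\<And>F. F \<in> K \<Longrightarrow> card F \<le> d" for K :: "nat set set"
  proof -
    have dim: "complex_dim K = int d - 1" using that by (intro complex_dim_eqI[of _ "{..<d}"]) auto
    show ?thesis
      using zero[OF that(1) dim] h_polynomial_eq[OF that(1) dim] by (simp add: b_def L_sum flip: L_def)
  qed
  have b_pos: "b m = 0" if m: "1 \<le> m" "m \<le> d" for m
  proof -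
    \<comment> \<open>\<open>G\<close> has \<open>m\<close> vertices outside \<open>{..<d}\<close>,
      and \<open>K\<close> joins the full simplex to the proper faces of \<open>G\<close>. So
      \<open>K\<close> and \<open>insert G K\<close> are complexes of dimension \<open>d - 1\<close>
      differing in one face.\<close>
    define G where "G = {d..<d + m}"
    define K where "K = Pow {..<d} \<union> (Pow G - {G})"
    have fin: "finite G" "finite K" by (auto simp: G_def K_def)
    have "d \<in> G" using m by (simp add: G_def)
    then have "G \<notin> K" by (auto simp: K_def)
    have "card G = m" by (simp add: G_def)
    have le: "card F \<le> d" if "F \<in> insert G K" for F
    proof -
      have "F \<subseteq> {..<d} \<or> F \<subseteq> G" using that by (auto simp: K_def)
      then show ?thesis
        using card_mono[of "{..<d}" F] card_mono[OF fin(1), of F] \<open>card G = m\<close> m by auto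
    qed
    have finF: "finite F" if "F \<in> insert G K" for F
      using that fin(1) by (auto simp: K_def intro: finite_subset)
    have K: "simplicial_complex K"
      unfolding simplicial_complex_def
    proof (intro conjI ballI allI impI)
      fix F H assume FH: "F \<in> K" "H \<subseteq> F"
      then show "H \<in> K" unfolding K_def by auto
    qed (use fin finF in \<open>auto simp: K_def\<close>)
    have "simplicial_complex (insert G K)"
      unfolding simplicial_complex_def
    proof (intro conjI ballI allI impI)
      fix F H assume FH: "F \<in> insert G K" "H \<subseteq> F"
      then show "H \<in> insert G K" unfolding K_def by auto
    qed (use fin finF in \<open>auto simp: K_def\<close>)
    then have "(\<Sum>F\<in>insert G K. b (card F)) = 0"
      by (rule sum_b) (use le in \<open>auto simp: K_def\<close>)
    moreover have "(\<Sum>F\<in>K. b (card F)) = 0"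
      using K by (rule sum_b) (use le in \<open>auto simp: K_def\<close>)
    ultimately show ?thesis using fin \<open>G \<notin> K\<close> \<open>card G = m\<close> by simp
  qed
  \<comment> \<open>The empty face lies in every complex, so \<open>b 0\<close> is isolated
    differently: in the full simplex all other terms vanish.\<close>
  have "(\<Sum>F\<in>Pow {..<d}. b (card F)) = 0"
  proof (rule sum_b)
    show "simplicial_complex (Pow {..<d})"
      by (auto simp: simplicial_complex_def intro: finite_subset)
    show "card F \<le> d" if "F \<in> Pow {..<d}" for F using that card_mono[of "{..<d}" F] by simp
  qed simp
  moreover have "b (card F) = 0" if "F \<in> Pow {..<d} - {{}}" for F
  proof (rule b_pos)
    have "finite F" using that finite_subset[of F "{..<d}"] by simp
    then show "1 \<le> card F" using that by (simp add: Suc_le_eq card_gt_0_iff)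
    show "card F \<le> d" using that card_mono[of "{..<d}" F] by simp
  qed
  ultimately have "b 0 = 0"
    by (subst (asm) sum.remove[of _ "{}"]) auto
  with b_pos have b: "b k = 0" if "k \<le> d" for k using that by (cases "k = 0") auto
  \<comment> \<open>Expanding a power of \<open>1 = x + (1 - x)\<close> writes \<open>x^j\<close> in
    terms of the polynomials behind \<open>b\<close>.\<close>
  have one: "[:0, 1:] + [:1, -1 :: real:] = 1" by (simp add: one_pCons)
  have "[:0, 1:] ^ j = [:0, 1:] ^ j * ([:0, 1:] + [:1, -1 :: real:]) ^ (d - j)"
    by (simp only: one power_one mult_1_right)
  also have "\<dots> = (\<Sum>k\<le>d - j. smult (of_nat ((d - j) choose k))
      ([:0, 1:] ^ (j + k) * [:1, -1:] ^ (d - (j + k))))"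
    unfolding binomial_ring sum_distrib_left
    by (rule sum.cong) (simp_all add: power_add mult_ac of_nat_poly)
  finally have "L ([:0, 1:] ^ j) = (\<Sum>k\<le>d - j. of_nat ((d - j) choose k) * b (j + k))"
    by (simp only: L_sum L_smult b_def)
  also have "\<dots> = 0" using j by (intro sum.neutral) (simp add: b)
  finally have "L (monom 1 j) = 0" by (simp add: monom_altdef)
  then show ?thesis using j by (simp add: L_def if_distrib[of "(*) _"] cong: if_cong)
qed

text \<open>Each row of the difference is a functional vanishing on all h-vectors.\<close>

lemma is_interval_h_matrix_unique:
  assumes d: "d \<ge> 1" and H: "is_interval_h_matrix d H" and H': "is_interval_h_matrix d H'"
  shows "H = H'"
proof (rule eq_matI)
  have dims: "H \<in> carrier_mat (d + 1) (d + 1)" "H' \<in> carrier_mat (d + 1) (d + 1)"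
    using H H' by (auto simp: is_interval_h_matrix_def)
  then show "dim_row H = dim_row H'" "dim_col H = dim_col H'" by auto
  fix i j assume "i < dim_row H'" "j < dim_col H'"
  then have ij: "i \<le> d" "j \<le> d" using dims by auto
  have "H $$ (i, j) - H' $$ (i, j) = 0"
  proof (rule functional_vanishing_on_h_polynomials[OF d _ ij(2)])
    fix K :: "nat set set" assume K: "simplicial_complex K" "complex_dim K = int d - 1"
    have "H *\<^sub>v h_vector K = H' *\<^sub>v h_vector K"
      using H H' K unfolding is_interval_h_matrix_def by metis
    moreover have mv: "vec_index (M *\<^sub>v h_vector K) i = (\<Sum>j\<le>d. M $$ (i, j) * coeff (h_polynomial K) j)"
      if "M \<in> carrier_mat (d + 1) (d + 1)" for M
      using that ij(1) K(2)
      by (auto simp: h_vector_def scalar_prod_def atLeast0LessThan lessThan_Suc_atMost intro!: sum.cong)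
    ultimately show "(\<Sum>j\<le>d. (H $$ (i, j) - H' $$ (i, j)) * coeff (h_polynomial K) j) = 0"
      using mv[OF dims(1)] mv[OF dims(2)] by (simp add: left_diff_distrib sum_subtractf)
  qed
  then show "H $$ (i, j) = H' $$ (i, j)" by simp
qed

lemma interval_h_matrix_eq:
  assumes "d \<ge> 1"
  shows "interval_h_matrix d = interval_matrix d"
  unfolding interval_h_matrix_def
  using is_interval_h_matrix_interval_matrix[OF assms] is_interval_h_matrix_unique[OF assms]
  by (intro the_equality) auto

theorem theorem4p2:
  fixes d :: nat
  assumes "d \<ge> 1"
  shows "totally_positive (interval_h_matrix d)"
  unfolding interval_h_matrix_eq[OF assms] by (rule totally_positive_interval_matrix)

end
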